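(* Let $p$ be an odd prime, let $A\in PSL_2(\mathbb F_p)$, and suppose that $A$ is similar to a Jordan block $$J_A=\begin{pmatrix}\lambda & 1\\ 0&\lambda\end{pmatrix}$$ with $\left(\frac{\lambda}{p}\right)=1$ in $\mathbb F_p$. Then there exists a square root $B$ of $A$ in $PSL_2(\mathbb F_p)$, i.e. $B\in PSL_2(\mathbb F_p)$ with $B^2=A$.
   Context: $PSL_2(\mathbb F_p)=SL_2(\mathbb F_p)/\{\pm E\}$, where $E$ is the identity matrix; its elements are represented by matrices in $SL_2(\mathbb F_p)$. $\left(\frac{\lambda}{p}\right)$ is the Legendre symbol, so $\left(\frac{\lambda}{p}\right)=1$ means that $\lambda$ is a nonzero square in $\mathbb F_p$. *)

theory Defs
  imports
    "HOL-Algebra.Coset"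
    "HOL-Number_Theory.Residues"
    "Jordan_Normal_Form.Determinant"
    "Jordan_Normal_Form.Jordan_Normal_Form"
    "Berlekamp_Zassenhaus.Finite_Field"
begin

definition SL2 :: "'a::field mat monoid" where
  "SL2 = \<lparr>carrier = {M \<in> carrier_mat 2 2. det M = 1},
          mult = (*),
          one = 1\<^sub>m 2\<rparr>"

text \<open>The elements of the quotient are the cosets \<open>{M, - M}\<close>, so the matrices
  representing an element are exactly its members.\<close>

definition PSL2 :: "'a::field mat set monoid" where
  "PSL2 = SL2 Mod {1\<^sub>m 2, - 1\<^sub>m 2}"

lemma SL2_simps [simp]:
  "carrier SL2 = {M \<in> carrier_mat 2 2. det M = 1}"
  "x \<otimes>\<^bsub>SL2\<^esub> y = x * y"
  "\<one>\<^bsub>SL2\<^esub> = 1\<^sub>m 2"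
  by (simp_all add: SL2_def)

lemma group_SL2: "group (SL2 :: 'a::field mat monoid)"
proof (rule groupI, goal_cases)
  case (1 x y) then show ?case by (auto simp: det_mult)
next
  case 2 show ?case by simp
next
  case (3 x y z) then show ?case by (auto intro: assoc_mult_mat)
next
  case (4 x) then show ?case by auto
next
  case (5 x)
  then have x: "x \<in> carrier_mat 2 2" "det x = 1" by auto
  then have a: "adj_mat x \<in> carrier_mat 2 2" "adj_mat x * x = 1\<^sub>m 2"
    using adj_mat[OF x(1)] by auto
  then have "det (adj_mat x) = 1"
    using det_mult[OF a(1) x(1)] x(2) by simp
  with a show ?case by (intro bexI[of _ "adj_mat x"]) auto
qed

lemma normal_pm_one: "{1\<^sub>m 2, - 1\<^sub>m 2} \<lhd> (SL2 :: 'a::field mat monoid)"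
proof -
  interpret group "SL2 :: 'a mat monoid" by (rule group_SL2)
  have "- 1\<^sub>m 2 = (- 1) \<cdot>\<^sub>m (1\<^sub>m 2 :: 'a mat)"
    by auto
  then have d: "det (- 1\<^sub>m 2 :: 'a mat) = 1"
    by (metis det_smult det_one index_one_mat(3) mult_1_right power2_minus power_one)
  have c: "(- 1\<^sub>m 2 :: 'a mat) \<in> carrier_mat 2 2" "(1\<^sub>m 2 :: 'a mat) \<in> carrier_mat 2 2"
    by auto
  have sq: "- 1\<^sub>m 2 * - 1\<^sub>m 2 = (1\<^sub>m 2 :: 'a mat)"
    using c by simp
  then have "inv\<^bsub>SL2\<^esub> (- 1\<^sub>m 2) = (- 1\<^sub>m 2 :: 'a mat)"
    using c d by (intro inv_equality) auto
  moreover have "inv\<^bsub>SL2\<^esub> (1\<^sub>m 2) = (1\<^sub>m 2 :: 'a mat)"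
    using inv_one by simp
  ultimately have "subgroup {1\<^sub>m 2, - 1\<^sub>m 2} (SL2 :: 'a mat monoid)"
    using c d sq by unfold_locales auto
  then show ?thesis
    by (rule normalI) (auto simp: r_coset_def l_coset_def)
qed

lemma group_PSL2: "group (PSL2 :: 'a::field mat set monoid)"
  unfolding PSL2_def by (rule normal.factorgroup_is_group[OF normal_pm_one])

end

theory Submission
  imports Defs
begin

text \<open>The idea is to show that \<open>A\<close> has odd order, because a cyclic group of odd order
  consists of squares.

  Let \<open>M\<close> be a representative of \<open>A\<close> that is similar to the Jordan block of \<open>\<lambda>\<close>. The
  off-diagonal entry of the \<open>p\<close>-th power of the block is \<open>p \<lambda>\<^sup>p\<^sup>-\<^sup>1\<close>, which
  vanishes in characteristic \<open>p\<close>. So the \<open>p\<close>-th power of \<open>M\<close> is the scalar matrix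
  \<open>\<lambda>\<^sup>p\<close> (\<open>pow_similar_jordan_block_2\<close>). Since \<open>det M = 1\<close> forces
  \<open>\<lambda>\<^sup>2 = 1\<close>, this scalar is \<open>1\<close> or \<open>-1\<close> and becomes trivial in
  \<open>PSL\<^sub>2\<close>. Hence the order of \<open>A\<close> divides the odd number \<open>p\<close>, and
  \<open>B\<close> can be taken to be \<open>A\<close> to the power \<open>(p + 1) / 2\<close>
  (\<open>square_if_odd_pow_eq_one\<close>).\<close>

text \<open>If \<open>n = 2 k + 1\<close>, then \<open>x\<close> to the power \<open>2 (k + 1) = n + 1\<close> is \<open>x\<close>
  itself, which exhibits the root.\<close>

lemma (in group) square_if_odd_pow_eq_one:
  assumes x: "x \<in> carrier G" and "x [^] n = \<one>" and "odd (n::nat)"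
  shows "\<exists>y\<in>carrier G. y [^] (2::nat) = x"
proof -
  from \<open>odd n\<close> obtain k where n: "n = 2 * k + 1" by (rule oddE)
  have "(x [^] Suc k) [^] (2::nat) = x [^] (Suc k * 2)"
    by (rule nat_pow_pow[OF x])
  also have "Suc k * 2 = Suc n"
    by (simp add: n)
  also have "x [^] Suc n = x"
    using x \<open>x [^] n = \<one>\<close> by simp
  finally show ?thesis
    by (rule bexI[OF _ nat_pow_closed[OF x]])
qed

text \<open>The block is \<open>a + N\<close> with \<open>N\<^sup>2 = 0\<close>, so the binomial expansion of its
  \<open>n\<close>-th power is \<open>a\<^sup>n + n a\<^sup>n\<^sup>-\<^sup>1 N\<close>, and the second term
  vanishes. The remaining scalar matrix is unchanged by conjugation.\<close>

lemma pow_similar_jordan_block_2: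
  fixes a :: "'a::comm_ring_1"
  assumes sim: "similar_mat M (jordan_block 2 a)" and n: "of_nat n = (0::'a)"
  shows "M ^\<^sub>m n = a ^ n \<cdot>\<^sub>m 1\<^sub>m 2"
proof -
  have J: "jordan_block 2 a ^\<^sub>m n = a ^ n \<cdot>\<^sub>m 1\<^sub>m 2"
  proof (rule eq_matI)
    fix i j assume "i < dim_row (a ^ n \<cdot>\<^sub>m 1\<^sub>m 2 :: 'a mat)" "j < dim_col (a ^ n \<cdot>\<^sub>m 1\<^sub>m 2 :: 'a mat)"
    then have "i = 0 \<or> i = 1" "j = 0 \<or> j = 1" by auto
    then show "(jordan_block 2 a ^\<^sub>m n) $$ (i, j) = (a ^ n \<cdot>\<^sub>m 1\<^sub>m 2) $$ (i, j)"
      using n by (elim disjE) (simp_all add: jordan_block_pow)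
  qed simp_all
  from sim obtain P Q where w: "similar_mat_wit M (jordan_block 2 a) P Q"
    by (auto simp: similar_mat_def)
  note wD = similar_mat_witD[OF refl w]
  have dim: "dim_row M = 2"
    using carrier_matD(1)[OF wD(5)] by (simp only: jordan_block_index)
  note c = wD(6,7)[unfolded dim] and PQ = wD(1)[unfolded dim]
  have "M ^\<^sub>m n = P * (a ^ n \<cdot>\<^sub>m 1\<^sub>m 2) * Q"
    by (simp add: similar_mat_wit_pow_id[OF w] J)
  also have "P * (a ^ n \<cdot>\<^sub>m 1\<^sub>m 2) = a ^ n \<cdot>\<^sub>m P"
    by (subst mult_smult_distrib[OF c(1) one_carrier_mat]) (simp add: right_mult_one_mat[OF c(1)])
  also have "a ^ n \<cdot>\<^sub>m P * Q = a ^ n \<cdot>\<^sub>m (P * Q)"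
    by (rule mult_smult_assoc_mat[OF c])
  finally show ?thesis by (simp add: PQ)
qed

lemma nat_pow_SL2:
  "M [^]\<^bsub>(SL2 :: 'a::field mat monoid)\<^esub> (n::nat) = M ^\<^sub>m n" if "M \<in> carrier_mat 2 2"
proof -
  interpret group "SL2 :: 'a mat monoid" by (rule group_SL2)
  show ?thesis using that by (induction n) simp_all
qed

text \<open>The two conditions on \<open>n\<close> make it an odd multiple of the characteristic, so this covers
  every field of odd characteristic.\<close>

lemma PSL2_square_if_jordan_block:
  fixes a :: "'a::field"
  assumes A: "A \<in> carrier PSL2" and M: "M \<in> A"
    and sim: "similar_mat M (jordan_block 2 a)"
    and n: "of_nat n = (0::'a)" "odd n"
  shows "\<exists>B\<in>carrier PSL2. B [^]\<^bsub>PSL2\<^esub> (2::nat) = A"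
proof -
  interpret N: normal "{1\<^sub>m 2, - 1\<^sub>m 2}" "SL2 :: 'a mat monoid"
    by (rule normal_pm_one)
  let ?N = "{1\<^sub>m 2, - 1\<^sub>m 2} :: 'a mat set"
  obtain g where g: "g \<in> carrier SL2" "A = ?N #>\<^bsub>SL2\<^esub> g"
    using A by (auto simp: PSL2_def FactGroup_def RCOSETS_def)
  have AM: "A = ?N #>\<^bsub>SL2\<^esub> M"
    using N.repr_independence[OF _ g(1) N.subgroup_axioms] M g(2) by blast
  have MC: "M \<in> carrier SL2"
    using N.r_coset_subset_G[OF N.subset g(1)] M g(2) by blast
  then have M2: "M \<in> carrier_mat 2 2" "det M = 1" by simp_all
  have "det (jordan_block 2 a) = a ^ 2"
    by (subst det_upper_triangular[of _ 2])
      (auto simp: diag_mat_def jordan_block_def numeral_2_eq_2)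
  then have "a ^ 2 = 1"
    using det_similar[OF sim] M2(2) by simp
  then have a: "a ^ n \<in> {1, - 1}"
    using n(2) by (auto simp: power2_eq_1_iff)
  have "M ^\<^sub>m n = a ^ n \<cdot>\<^sub>m 1\<^sub>m 2"
    by (rule pow_similar_jordan_block_2[OF sim n(1)])
  also have "\<dots> \<in> ?N"
  proof -
    have "- 1 \<cdot>\<^sub>m 1\<^sub>m 2 = (- 1\<^sub>m 2 :: 'a mat)" by (intro eq_matI) auto
    moreover have "1 \<cdot>\<^sub>m 1\<^sub>m 2 = (1\<^sub>m 2 :: 'a mat)" by (intro eq_matI) auto
    ultimately show ?thesis using a by auto
  qed
  finally have ker: "M [^]\<^bsub>SL2\<^esub> n \<in> ?N"
    by (simp add: nat_pow_SL2[OF M2(1)])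
  have "A [^]\<^bsub>PSL2\<^esub> n = ?N #>\<^bsub>SL2\<^esub> (M [^]\<^bsub>SL2\<^esub> n)"
    unfolding PSL2_def AM by (rule N.FactGroup_pow[OF MC])
  also have "\<dots> = \<one>\<^bsub>PSL2\<^esub>"
    using N.rcos_const[OF N.is_group ker] by (simp add: PSL2_def FactGroup_def)
  finally show ?thesis
    by (rule group.square_if_odd_pow_eq_one[OF group_PSL2 A _ n(2)])
qed

theorem theorem23:
  fixes p :: nat
    and lam :: "'p::prime_card mod_ring"
    and A :: "'p mod_ring mat set"
  assumes "p = CARD('p)" and "prime p" and "odd p"
    and "A \<in> carrier PSL2"
    and "\<exists>M\<in>A. similar_mat M (jordan_block 2 lam)"
    and "Legendre (to_int_mod_ring lam) (int p) = 1"
  shows "\<exists>B\<in>carrier PSL2. B [^]\<^bsub>PSL2\<^esub> (2::nat) = A"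
proof -
  from assms(5) obtain M where M: "M \<in> A" "similar_mat M (jordan_block 2 lam)" by blast
  have "of_nat p = (0 :: 'p mod_ring)"
    by (simp add: assms(1))
  then show ?thesis
    by (rule PSL2_square_if_jordan_block[OF assms(4) M _ assms(3)])
qed

end
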